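(* If $T$ is a tree, then $\mathrm{gp}_{\mathrm g}'(T)\le \ell(T)-\Delta(T)+2$.
   Context: All graphs are finite, simple and undirected. $\ell(T)$ is the number of leaves (vertices of degree $1$) of $T$, and $\Delta(T)$ is its maximum degree. A set $S\subseteq V(G)$ is in general position if no shortest path of $G$ contains more than two vertices of $S$. In the Builder-Blocker general position game on a graph $G$, two players, Builder and Blocker, alternately choose (mark) an unmarked vertex of $G$ so that at each stage the set of all marked vertices is in general position; the game ends when no further vertex can be selected. Builder aims to make the final set of marked vertices as large as possible, Blocker as small as possible. In the B'-game Blocker moves first. $\mathrm{gp}_{\mathrm g}'(G)$ is the number of vertices in the final set when the B'-game is played optimally by both players. *)

theory Defs
  imports
    "Graph_Theory.Digraph_Component"
    "Graph_Theory.Vertex_Walk"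
begin

text \<open>
  Finite simple undirected graphs are the \<^locale>\<open>graph\<close>s of Graph_Theory: finite symmetric
  digraphs without loops and parallel arcs. Every undirected edge is thus a pair of opposite arcs,
  and the degree of a vertex is its \<^const>\<open>out_degree\<close>.
\<close>

text \<open>
  The library predicate \<^const>\<open>tree\<close> cannot be used here, since \<^const>\<open>pre_digraph.cycle\<close> counts
  going back and forth along an edge as a cycle of length 2. In a simple symmetric digraph the
  undirected cycles are exactly the cycles of length at least 3. Connectedness includes that
  the vertex set is nonempty.
\<close>
definition undirected_tree :: "('a, 'b) pre_digraph \<Rightarrow> bool" where
  "undirected_tree G \<longleftrightarrow>
     graph G \<and> connected G \<and> \<not> (\<exists>p. pre_digraph.cycle G p \<and> 3 \<le> length p)"

definition num_leaves :: "('a, 'b) pre_digraph \<Rightarrow> nat" where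
  "num_leaves G = card {v \<in> verts G. out_degree G v = 1}"

definition max_degree :: "('a, 'b) pre_digraph \<Rightarrow> nat" where
  "max_degree G = Max (out_degree G ` verts G)"

definition shortest_path :: "('a, 'b) pre_digraph \<Rightarrow> 'a list \<Rightarrow> bool" where
  "shortest_path G p \<longleftrightarrow> vpath p G \<and>
     (\<forall>q. vpath q G \<and> hd q = hd p \<and> last q = last p \<longrightarrow> vwalk_length p \<le> vwalk_length q)"

definition general_position :: "('a, 'b) pre_digraph \<Rightarrow> 'a set \<Rightarrow> bool" where
  "general_position G S \<longleftrightarrow>
     S \<subseteq> verts G \<and> (\<forall>p. shortest_path G p \<longrightarrow> card (set p \<inter> S) \<le> 2)"

definition legal_moves :: "('a, 'b) pre_digraph \<Rightarrow> 'a set \<Rightarrow> 'a set" where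
  "legal_moves G S = {v \<in> verts G - S. general_position G (insert v S)}"

datatype player = Builder | Blocker

text \<open>
  The number of marked vertices at the end of the game under optimal play, when the set \<open>S\<close> is
  already marked and the given player is to move. The finiteness test only serves termination;
  it holds for every graph considered.
\<close>
function game_value :: "('a, 'b) pre_digraph \<Rightarrow> player \<Rightarrow> 'a set \<Rightarrow> nat" where
  "game_value G Builder S =
     (if finite (verts G) \<and> legal_moves G S \<noteq> {}
      then Max ((\<lambda>v. game_value G Blocker (insert v S)) ` legal_moves G S) else card S)"
| "game_value G Blocker S =
     (if finite (verts G) \<and> legal_moves G S \<noteq> {}
      then Min ((\<lambda>v. game_value G Builder (insert v S)) ` legal_moves G S) else card S)"
  by pat_completeness auto
termination
  by (relation "measure (\<lambda>(G, _, S). card (verts G - S))")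
     (auto simp: legal_moves_def simp del: card_Diff_insert intro!: psubset_card_mono)

text \<open>The Blocker-start (B') game: no vertex is marked yet and Blocker moves first.\<close>
definition gp_game' :: "('a, 'b) pre_digraph \<Rightarrow> nat" where
  "gp_game' G = game_value G Blocker {}"

end

theory Submission
  imports Defs
begin

text \<open>
  Blocker's first move is a vertex \<open>v\<close> of maximum degree; whatever happens afterwards, the final
  set \<open>S\<close> is in general position and contains \<open>v\<close>. So it suffices that every such set satisfies
  \<open>card S + deg v \<le> l + 2\<close> with \<open>l\<close> the number of leaves (\<open>general_position_card_le\<close>).

  Root the tree at \<open>v\<close>. Paths in a tree are unique (\<open>vpath_unique\<close>), so every path is a shortest
  path. Hence no element of \<open>S\<close> other than \<open>v\<close> lies between \<open>v\<close> and another one, and two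
  elements of \<open>S\<close> cannot have \<open>v\<close> between them: all of \<open>S - {v}\<close> sits in one branch at \<open>v\<close>,
  entered through a neighbour \<open>c\<close> (\<open>general_position_same_branch\<close>). The other \<open>deg v - 1\<close>
  neighbours of \<open>v\<close> start branches free of \<open>S\<close>. Therefore \<open>S - {v}\<close> together with these
  neighbours is an antichain of the rooted tree, with \<open>card S - 1 + deg v - 1\<close> elements. Choosing
  for each of its members a leaf on the far side of it, seen from \<open>v\<close>, is injective, so the
  antichain has at most \<open>l\<close> elements (\<open>antichain_card_le_leaves\<close>).
\<close>

section \<open>Unique paths in trees\<close>

locale undirected_tree_graph = graph +
  assumes tree: "undirected_tree G"
begin

lemma arcs_ends_sym: "(u, v) \<in> arcs_ends G \<Longrightarrow> (v, u) \<in> arcs_ends G"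
  using arcs_ends_symmetric[OF sym_arcs] .

lemma vwalk_imp_awalk:
  assumes "vwalk q G"
  shows "\<exists>p. awalk (hd q) p (last q) \<and> awalk_verts (hd q) p = q"
  using assms
proof (induction q rule: vwalk_induct)
  case (Base u)
  then show ?case by (intro exI[of _ "[]"]) (simp add: awalk_Nil_iff)
next
  case (Cons u v es)
  then obtain p where p: "awalk v p (last (v # es))" "awalk_verts v p = v # es" by auto
  from Cons obtain e where e: "e \<in> arcs G" "tail G e = u" "head G e = v" by auto
  show ?case
    using p e by (intro exI[of _ "e # p"]) (auto simp: awalk_Cons_iff)
qed

text \<open>
  Putting the closing arc in front makes the vertex list of the closed walk \<open>last q # q\<close>, whose
  tail is the path itself and thus distinct, as a library cycle requires.
\<close>
lemma no_vertex_cycle: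
  assumes "vpath q G" "3 \<le> length q" "(last q, hd q) \<in> arcs_ends G"
  shows False
proof -
  from assms obtain p where p: "awalk (hd q) p (last q)" "awalk_verts (hd q) p = q"
    using vwalk_imp_awalk by blast
  from assms(3) obtain e where e: "e \<in> arcs G" "tail G e = last q" "head G e = hd q" by auto
  have "awalk (last q) (e # p) (last q)" "awalk_verts (last q) (e # p) = last q # q"
    using p e by (auto simp: awalk_Cons_iff)
  moreover have "distinct q" using assms by auto
  ultimately have "cycle (e # p)" unfolding cycle_def by (intro exI[of _ "last q"]) simp
  moreover have "length q = length (e # p)"
    using length_awalk_verts[of "hd q" p] p by simp
  ultimately show False using tree assms(2) unfolding undirected_tree_def by metis
qed

lemma vpath_Cons_Cons:
  "vpath (u # v # p) G \<longleftrightarrow> (u, v) \<in> arcs_ends G \<and> u \<notin> set (v # p) \<and> vpath (v # p) G"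
  by (auto simp: vpath_def)

lemma vpath_rev: "vpath p G \<Longrightarrow> vpath (rev p) G"
  using vwalk_rev_ex[OF sym_arcs] by (auto simp: vpath_def)

lemma vpath_prefix: "vpath (p @ q) G \<Longrightarrow> p \<noteq> [] \<Longrightarrow> vpath p G"
  by (auto simp: vpath_def intro: vwalkI_append_l)

text \<open>
  If two paths start with different edges, following the first until it hits the second and
  returning along the second closes a cycle. Otherwise the common first vertex can be dropped.
\<close>
lemma vpath_unique:
  assumes "vpath p G" "vpath q G" "hd p = hd q" "last p = last q"
  shows "p = q"
  using assms
proof (induction p arbitrary: q rule: induct_list012)
  case 1
  then show ?case by (auto simp: vpath_def vwalk_def)
next
  case (2 u)
  then obtain q' where "q = u # q'" by (cases q) (auto simp: vpath_def vwalk_def)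
  with 2 show ?case by (cases q') (auto simp: vpath_def split: if_splits)
next
  case (3 u v p)
  then obtain q1 where q: "q = u # q1" by (cases q) (auto simp: vpath_def vwalk_def)
  with 3 have "q1 \<noteq> []" by (auto simp: vpath_def split: if_splits)
  then obtain w q' where q1: "q1 = w # q'" by (cases q1) auto
  show ?case
  proof (cases "v = w")
    case True
    with 3 q q1 have "v # p = w # q'" by (intro "3.IH"(2)) (auto simp: vpath_Cons_Cons)
    then show ?thesis using q q1 by simp
  next
    case False
    have "last (v # p) \<in> set (w # q')" using 3 q q1 by (auto split: if_splits)
    then have "\<exists>x \<in> set (v # p). x \<in> set (w # q')" by (metis last_in_set list.distinct(1))
    \<comment> \<open>\<open>z\<close> is where the first path meets the second; the cycle is \<open>u\<close>, \<open>a\<close>, \<open>z\<close>, reversed \<open>c\<close>.\<close>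
    from split_list_first_prop[OF this] obtain a z b where
      a: "v # p = a @ z # b" "z \<in> set (w # q')" "\<forall>x \<in> set a. x \<notin> set (w # q')"
      by metis
    then obtain c d where c: "w # q' = c @ z # d" by (meson split_list)
    have "vpath (u # a @ [z]) G"
      using vpath_prefix[of "u # a @ [z]" b] 3(3) a(1) by simp
    moreover have "vpath (c @ [z]) G"
      using vpath_prefix[of "c @ [z]" d] 3(4) c unfolding q q1 vpath_Cons_Cons by simp
    then have "vpath (z # rev c) G" using vpath_rev by force
    moreover have "u \<notin> set (w # q')" using 3(4) q q1 by (auto simp: vpath_Cons_Cons)
    ultimately have "vpath (u # a @ z # rev c) G"
      using a(3) c vwalk_joinI_vwalk'[of "u # a @ [z]" G "z # rev c"]
      by (auto simp: vpath_def vwalk_join_def)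
    moreover have "last (z # rev c) = w" using c by (cases c) auto
    then have "last (u # a @ z # rev c) = w" by simp
    moreover have "(w, u) \<in> arcs_ends G"
      using 3(4) q q1 by (auto simp: vpath_Cons_Cons intro: arcs_ends_sym)
    moreover have "a \<noteq> [] \<or> c \<noteq> []" using False a(1) c by auto
    then have "3 \<le> length (u # a @ z # rev c)" by (cases a; cases c) auto
    ultimately show ?thesis using no_vertex_cycle by (metis list.sel(1))
  qed
qed

lemma vpath_imp_shortest_path: "vpath p G \<Longrightarrow> shortest_path G p"
  unfolding shortest_path_def using vpath_unique by blast

definition tree_path :: "'a \<Rightarrow> 'a \<Rightarrow> 'a list" where
  "tree_path u w = (THE p. vpath p G \<and> hd p = u \<and> last p = w)"

lemma tree_path_eqI:
  assumes "vpath p G" "hd p = u" "last p = w"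
  shows "tree_path u w = p"
  unfolding tree_path_def using assms vpath_unique by blast

lemma tree_path:
  assumes "u \<in> verts G" "w \<in> verts G"
  shows "vpath (tree_path u w) G" "hd (tree_path u w) = u" "last (tree_path u w) = w"
    "tree_path u w \<noteq> []"
proof -
  have "strongly_connected G"
    using tree symmetric_connected_imp_strongly_connected[OF sym_arcs]
    by (simp add: undirected_tree_def)
  then have "u \<rightarrow>\<^sup>*\<^bsub>G\<^esub> w" using assms by auto
  then obtain p where "vpath p G" "hd p = u" "last p = w" by (auto simp: reachable_vpath_conv)
  with tree_path_eqI[OF this]
  show "vpath (tree_path u w) G" "hd (tree_path u w) = u" "last (tree_path u w) = w"
    "tree_path u w \<noteq> []"
    by (auto simp: vpath_def vwalk_def)
qed

section \<open>The tree order of a rooted tree\<close>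

text \<open>
  The tree rooted at \<open>v\<close> is ordered by \<open>s \<in> set (tree_path v x)\<close>: \<open>s\<close> is an ancestor of \<open>x\<close> or
  \<open>x\<close> itself. By uniqueness of paths, the path to an ancestor is an initial segment, and hence the
  ancestors of a vertex form a chain.
\<close>

lemma tree_path_prefix:
  assumes "v \<in> verts G" "x \<in> verts G" "tree_path v x = p @ s # q"
  shows "tree_path v s = p @ [s]"
proof (rule tree_path_eqI)
  show "vpath (p @ [s]) G"
    using vpath_prefix[of "p @ [s]" q] tree_path(1)[OF assms(1,2)] assms(3) by simp
  show "hd (p @ [s]) = v" using tree_path(2)[OF assms(1,2)] assms(3) by (cases p) auto
qed simp

lemma tree_path_comparable:
  assumes v: "v \<in> verts G" and x: "x \<in> verts G"
    and a: "a \<in> set (tree_path v x)" and b: "b \<in> set (tree_path v x)"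
  shows "a \<in> set (tree_path v b) \<or> b \<in> set (tree_path v a)"
proof -
  obtain p q where pq: "tree_path v x = p @ a # q" using a by (meson split_list)
  obtain r s where rs: "tree_path v x = r @ b # s" using b by (meson split_list)
  have "tree_path v a = p @ [a]" "tree_path v b = r @ [b]"
    using tree_path_prefix[OF v x pq] tree_path_prefix[OF v x rs] by auto
  moreover have "a \<in> set (r @ [b]) \<or> b \<in> set (p @ [a])"
    using pq[unfolded rs] by (auto simp: append_eq_append_conv2 append_eq_Cons_conv Cons_eq_append_conv)
  ultimately show ?thesis by simp
qed

lemma tree_path_edge: "(v, c) \<in> arcs_ends G \<Longrightarrow> tree_path v c = [v, c]"
  by (rule tree_path_eqI) (auto simp: vpath_def adj_in_verts dest: adj_not_same)

lemma tree_path_self: "v \<in> verts G \<Longrightarrow> tree_path v v = [v]"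
  by (rule tree_path_eqI) (auto simp: vpath_self)

definition neighbours :: "'a \<Rightarrow> 'a set" where
  "neighbours v = {w. (v, w) \<in> arcs_ends G}"

lemma finite_neighbours: "finite (neighbours v)"
  by (rule finite_subset[of _ "verts G"]) (auto simp: neighbours_def adj_in_verts)

lemma out_degree_eq_card_neighbours: "out_degree G v = card (neighbours v)"
proof -
  have "neighbours v = head G ` out_arcs G v" by (force simp: neighbours_def arcs_ends_conv)
  moreover have "inj_on (head G) (out_arcs G v)"
    by (rule inj_onI) (auto intro!: no_multi_arcs simp: arc_to_ends_def)
  ultimately show ?thesis by (simp add: out_degree_def card_image)
qed

text \<open>
  The components of the tree without \<open>v\<close> are represented by the neighbour of \<open>v\<close> that they
  contain; \<open>branch v s\<close> is that neighbour for the component of \<open>s\<close>, and is meaningful for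
  \<open>s \<noteq> v\<close> only.
\<close>
definition branch :: "'a \<Rightarrow> 'a \<Rightarrow> 'a" where
  "branch v s = hd (tl (tree_path v s))"

lemma tree_path_branch:
  assumes "v \<in> verts G" "s \<in> verts G" "s \<noteq> v"
  obtains p where "tree_path v s = v # branch v s # p"
  using tree_path[OF assms(1,2)] assms(3) unfolding branch_def
  by (cases "tree_path v s"; cases "tl (tree_path v s)") auto

lemma branch_in_neighbours:
  assumes "v \<in> verts G" "s \<in> verts G" "s \<noteq> v"
  shows "branch v s \<in> neighbours v"
  using tree_path_branch[OF assms] tree_path(1)[OF assms(1,2)]
  by (metis vpath_Cons_Cons neighbours_def mem_Collect_eq)

lemma branch_neighbour: "c \<in> neighbours v \<Longrightarrow> branch v c = c"
  by (simp add: neighbours_def branch_def tree_path_edge)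

lemma branch_below:
  assumes "v \<in> verts G" "x \<in> verts G" "s \<in> set (tree_path v x)" "s \<noteq> v"
  shows "branch v s = branch v x"
proof -
  obtain p q where pq: "tree_path v x = p @ s # q" using assms(3) by (meson split_list)
  have "tree_path v s = p @ [s]" using tree_path_prefix[OF assms(1,2) pq] .
  moreover have "p \<noteq> []" using pq tree_path[OF assms(1,2)] assms(4) by auto
  ultimately show ?thesis unfolding branch_def pq by (cases p; cases "tl p") auto
qed

text \<open>
  A vertex other than \<open>v\<close> on both halves would have the branch of \<open>s\<close> as well as that of \<open>t\<close>.
\<close>
lemma vpath_through_root:
  assumes v: "v \<in> verts G" and s: "s \<in> verts G" "s \<noteq> v" and t: "t \<in> verts G" "t \<noteq> v"
    and ne: "branch v s \<noteq> branch v t"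
  shows "vpath (rev (tree_path v s) @ tl (tree_path v t)) G"
proof -
  obtain p where p: "tree_path v s = v # branch v s # p" using tree_path_branch[OF v s] .
  obtain q where q: "tree_path v t = v # branch v t # q" using tree_path_branch[OF v t] .
  have vs: "vpath (tree_path v s) G" and vt: "vpath (tree_path v t) G"
    using tree_path[OF v] s t by auto
  have "set (tree_path v s) \<inter> set (tl (tree_path v t)) = {}"
  proof (rule ccontr)
    assume "\<not> ?thesis"
    then obtain z where z: "z \<in> set (tree_path v s)" "z \<in> set (tl (tree_path v t))" by auto
    then have "z \<noteq> v" using vt q by (auto simp: vpath_def)
    moreover have "z \<in> set (tree_path v t)" using z(2) q by auto
    ultimately show False using z(1) ne branch_below[OF v] s(1) t(1) by metis
  qed
  moreover have "vwalk (rev (tree_path v s) \<oplus> tree_path v t) G"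
    using vpath_rev[OF vs] vt p q by (intro vwalk_joinI_vwalk') (auto simp: vpath_def)
  ultimately show ?thesis using vs vt by (auto simp: vpath_def vwalk_join_def distinct_tl)
qed

section \<open>Antichains and leaves\<close>

definition leaves :: "'a set" where
  "leaves = {x \<in> verts G. out_degree G x = 1}"

text \<open>
  A farthest descendant \<open>x\<close> of \<open>s\<close> is a leaf: a neighbour of \<open>x\<close> off the path from \<open>v\<close> to \<open>x\<close>
  would be a farther descendant, and a neighbour on this path can only be its last but one vertex
  since paths are unique. The vertex \<open>s\<close> must not be the root, which may be the only vertex.
\<close>
lemma leaf_above:
  assumes v: "v \<in> verts G" and s: "s \<in> verts G" "s \<noteq> v"
  shows "\<exists>x \<in> leaves. s \<in> set (tree_path v x)"
proof -
  let ?above = "\<lambda>x. x \<in> verts G \<and> s \<in> set (tree_path v x)"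
  have "?above s" using s tree_path[OF v s(1)] last_in_set[of "tree_path v s"] by simp
  moreover have "\<forall>x. ?above x \<longrightarrow> length (tree_path v x) < Suc (card (verts G))"
  proof (intro allI impI)
    fix x assume "?above x"
    then have "vpath (tree_path v x) G" using tree_path(1)[OF v] by simp
    then have "length (tree_path v x) = card (set (tree_path v x))"
        "set (tree_path v x) \<subseteq> verts G"
      by (auto simp: vpath_def vwalk_def distinct_card)
    then show "length (tree_path v x) < Suc (card (verts G))"
      using card_mono[OF finite_verts] by (metis le_imp_less_Suc)
  qed
  ultimately obtain x where x: "x \<in> verts G" "s \<in> set (tree_path v x)"
      and max: "\<And>y. ?above y \<Longrightarrow> length (tree_path v y) \<le> length (tree_path v x)"
    using ex_has_greatest_nat[of ?above s "\<lambda>x. length (tree_path v x)"] by blast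
  have px: "vpath (tree_path v x) G" "hd (tree_path v x) = v" "last (tree_path v x) = x"
    using tree_path[OF v x(1)] by auto
  have "x \<noteq> v" using x s tree_path_self[OF v] by auto
  then obtain p where p: "tree_path v x = p @ [x]" "p \<noteq> []"
    using px tree_path(4)[OF v x(1)]
    by (metis append_butlast_last_id append_Nil list.sel(1))
  have "y = last p" if y: "y \<in> neighbours x" for y
  proof -
    have yx: "(x, y) \<in> arcs_ends G" "y \<in> verts G"
      using y adj_in_verts by (auto simp: neighbours_def)
    have "y \<in> set (tree_path v x)"
    proof (rule ccontr)
      assume new: "y \<notin> set (tree_path v x)"
      have "vwalk (tree_path v x \<oplus> [x, y]) G"
        using px yx x by (intro vwalk_joinI_vwalk') (auto simp: vpath_def)
      then have "vpath (tree_path v x @ [y]) G"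
        using px new by (auto simp: vpath_def vwalk_join_def)
      then have "tree_path v y = tree_path v x @ [y]"
        using px(2) p by (intro tree_path_eqI) auto
      then show False using max[of y] x yx by simp
    qed
    moreover have "y \<noteq> x" using yx adj_not_same by blast
    ultimately have "y \<in> set p" using p by simp
    then obtain q r where qr: "p = q @ y # r" by (meson split_list)
    have "vpath (q @ [y, x]) G"
    proof -
      have path: "vpath ((q @ [y]) @ r @ [x]) G" using px(1) unfolding p(1) qr by simp
      then have qy: "vpath (q @ [y]) G" by (rule vpath_prefix) simp
      then have "vwalk ((q @ [y]) \<oplus> [y, x]) G"
        using x arcs_ends_sym[OF yx(1)]
        by (intro vwalk_joinI_vwalk') (auto simp: vpath_def)
      then show ?thesis using path by (auto simp: vpath_def vwalk_join_def)
    qed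
    moreover have "hd (q @ [y, x]) = v"
    proof -
      have "hd ((q @ [y]) @ r @ [x]) = v" using px(2) unfolding p(1) qr by simp
      then show ?thesis by (cases q) simp_all
    qed
    ultimately have "tree_path v x = q @ [y, x]" by (rule tree_path_eqI) simp
    then have "p @ [x] = (q @ [y]) @ [x]" unfolding p(1) by simp
    then show ?thesis by simp
  qed
  moreover have "last p \<in> neighbours x"
  proof -
    have rev_path: "rev (p @ [x]) = x # last p # rev (butlast p)"
      using p(2) by (cases p rule: rev_cases) auto
    have "vpath (rev (p @ [x])) G" using px(1) vpath_rev unfolding p(1) by blast
    then have "(x, last p) \<in> arcs_ends G" unfolding rev_path vpath_Cons_Cons by blast
    then show ?thesis by (simp add: neighbours_def)
  qed
  ultimately have "neighbours x = {last p}" by blast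
  then have "x \<in> leaves" using x by (simp add: leaves_def out_degree_eq_card_neighbours)
  then show ?thesis using x by blast
qed

text \<open>
  Two members to which \<open>leaf_above\<close> assigns the same leaf are ancestors of it, hence comparable.
\<close>
lemma antichain_card_le_leaves:
  assumes v: "v \<in> verts G" and A: "A \<subseteq> verts G - {v}"
    and anti: "\<And>a b. a \<in> A \<Longrightarrow> b \<in> A \<Longrightarrow> a \<in> set (tree_path v b) \<Longrightarrow> a = b"
  shows "card A \<le> card leaves"
proof -
  obtain f where f: "\<And>a. a \<in> A \<Longrightarrow> f a \<in> leaves \<and> a \<in> set (tree_path v (f a))"
    using leaf_above[OF v] A by (metis DiffD1 DiffD2 singletonI subsetD)
  have "inj_on f A"
  proof (rule inj_onI)
    fix a b assume ab: "a \<in> A" "b \<in> A" "f a = f b"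
    then have "a \<in> set (tree_path v (f a))" "b \<in> set (tree_path v (f a))" "f a \<in> verts G"
      using f[of a] f[of b] by (auto simp: leaves_def)
    then show "a = b" using tree_path_comparable[OF v] anti ab by metis
  qed
  moreover have "finite leaves" by (simp add: leaves_def)
  ultimately show ?thesis using f by (auto intro: card_inj_on_le)
qed

section \<open>General position sets containing a given vertex\<close>

lemma general_position_on_vpath:
  assumes "general_position G S" "vpath p G" "{a, b, c} \<subseteq> set p \<inter> S"
    "a \<noteq> b" "b \<noteq> c" "a \<noteq> c"
  shows False
proof -
  have "card {a, b, c} \<le> card (set p \<inter> S)" using assms(3) by (intro card_mono) auto
  moreover have "card (set p \<inter> S) \<le> 2"
    using assms(1,2) vpath_imp_shortest_path by (auto simp: general_position_def)
  ultimately show False using assms(4-6) by simp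
qed

text \<open>
  Otherwise the path from \<open>s\<close> to \<open>t\<close> runs through \<open>v\<close> and contains three members of \<open>S\<close>.
\<close>
lemma general_position_same_branch:
  assumes S: "general_position G S" "v \<in> S" and s: "s \<in> S" "s \<noteq> v" and t: "t \<in> S" "t \<noteq> v"
  shows "branch v s = branch v t"
proof (rule ccontr)
  assume ne: "branch v s \<noteq> branch v t"
  have V: "v \<in> verts G" "s \<in> verts G" "t \<in> verts G"
    using S s t by (auto simp: general_position_def)
  let ?p = "rev (tree_path v s) @ tl (tree_path v t)"
  have "vpath ?p G" using vpath_through_root V s t ne by blast
  moreover have "v \<in> set ?p" "s \<in> set ?p"
    using tree_path[OF V(1,2)] hd_in_set[of "tree_path v s"] last_in_set[of "tree_path v s"]
    by auto
  moreover have "t \<in> set ?p"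
    using tree_path[OF V(1,3)] t(2) by (cases "tree_path v t") (auto split: if_splits)
  ultimately show False
    using general_position_on_vpath[OF S(1), of ?p v s t] S s t ne by auto
qed

text \<open>
  The bound comes from the antichain formed by \<open>S - {v}\<close> and the neighbours of \<open>v\<close> other than the
  one that leads to \<open>S - {v}\<close>. An ancestor of some \<open>b \<in> S\<close> among these neighbours would be the
  branch of \<open>b\<close>, which is the excluded neighbour.
\<close>
lemma general_position_card_le:
  assumes S: "general_position G S" "v \<in> S"
  shows "card S + out_degree G v \<le> card leaves + 2"
proof -
  have SV: "S \<subseteq> verts G" and v: "v \<in> verts G" using S by (auto simp: general_position_def)
  have finS: "finite S" using SV finite_verts by (rule finite_subset)
  have cS: "card S = Suc (card (S - {v}))" using card.remove[OF finS S(2)] .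
  show ?thesis
  proof (cases "neighbours v = {}")
    case True
    then have "S - {v} = {}" using branch_in_neighbours[OF v] SV by blast
    then have "card (S - {v}) = 0" by (simp only: card.empty)
    then show ?thesis using True cS by (simp add: out_degree_eq_card_neighbours)
  next
    case False
    \<comment> \<open>If \<open>S = {v}\<close>, any neighbour may be left out.\<close>
    obtain c where c: "c \<in> neighbours v" "\<And>s. s \<in> S \<Longrightarrow> s \<noteq> v \<Longrightarrow> branch v s = c"
    proof (cases "S - {v} = {}")
      case True
      moreover obtain c where "c \<in> neighbours v" using False by auto
      ultimately show ?thesis using that[of c] by auto
    next
      case nonempty: False
      then obtain t where t: "t \<in> S" "t \<noteq> v" by auto
      then have "branch v t \<in> neighbours v" using branch_in_neighbours[OF v] SV by blast
      then show ?thesis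
        using that[of "branch v t"] general_position_same_branch[OF S _ _ t] by simp
    qed
    let ?A = "(S - {v}) \<union> (neighbours v - {c})"
    have N: "neighbours v \<subseteq> verts G - {v}"
      using adj_in_verts adj_not_same by (auto simp: neighbours_def)
    have "card ?A \<le> card leaves"
    proof (rule antichain_card_le_leaves[OF v])
      show "?A \<subseteq> verts G - {v}" using N SV by auto
      fix a b assume a: "a \<in> ?A" and b: "b \<in> ?A" and ab: "a \<in> set (tree_path v b)"
      have V: "a \<in> verts G" "a \<noteq> v" "b \<in> verts G" "b \<noteq> v" using a b N SV by auto
      show "a = b"
      proof (cases "b \<in> neighbours v - {c}")
        case True
        then have "tree_path v b = [v, b]" using tree_path_edge by (simp add: neighbours_def)
        then show ?thesis using ab V by simp
      next
        case bS: False
        then have bS: "b \<in> S" using b by auto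
        show ?thesis
        proof (cases "a \<in> neighbours v - {c}")
          case True
          then show ?thesis
            using branch_neighbour[of a v] branch_below[OF v V(3) ab V(2)] c(2)[OF bS V(4)] by auto
        next
          case False
          then have aS: "a \<in> S" using a by auto
          have "v \<in> set (tree_path v b)" "b \<in> set (tree_path v b)"
            using tree_path[OF v V(3)] hd_in_set[of "tree_path v b"] last_in_set[of "tree_path v b"]
            by auto
          then show ?thesis
            using general_position_on_vpath[OF S(1) tree_path(1)[OF v V(3)], of v a b]
              ab aS bS S(2) V by auto
        qed
      qed
    qed
    moreover have "(S - {v}) \<inter> (neighbours v - {c}) = {}"
      using c(2) branch_neighbour by force
    then have "card ?A = card (S - {v}) + card (neighbours v - {c})"
      using finS finite_neighbours by (intro card_Un_disjoint) auto
    moreover have "card (neighbours v) = Suc (card (neighbours v - {c}))"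
      using card.remove[OF finite_neighbours c(1)] .
    ultimately show ?thesis using cS by (simp add: out_degree_eq_card_neighbours)
  qed
qed

end

section \<open>The game\<close>

declare game_value.simps [simp del]

text \<open>
  Marked vertices stay marked, so the final set is a general position set that includes the current
  one; a bound on all such sets bounds the value irrespective of how the players move.
\<close>
lemma game_value_le:
  assumes "general_position G S"
    and "\<And>S'. general_position G S' \<Longrightarrow> S \<subseteq> S' \<Longrightarrow> card S' \<le> k"
  shows "game_value G player S \<le> k"
  using assms
proof (induction G player S rule: game_value.induct)
  case (1 G S)
  show ?case
  proof (cases "finite (verts G) \<and> legal_moves G S \<noteq> {}")
    case True
    then have "finite (legal_moves G S)" by (simp add: legal_moves_def)
    moreover have "game_value G Blocker (insert u S) \<le> k" if u: "u \<in> legal_moves G S" for u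
      using u True "1.prems" by (intro "1.IH") (auto simp: legal_moves_def)
    ultimately show ?thesis using True by (simp add: game_value.simps(1)[of G S])
  qed (use "1.prems" in \<open>auto simp: game_value.simps(1)[of G S]\<close>)
next
  case (2 G S)
  show ?case
  proof (cases "finite (verts G) \<and> legal_moves G S \<noteq> {}")
    case True
    then have fin: "finite (legal_moves G S)" by (simp add: legal_moves_def)
    obtain u where u: "u \<in> legal_moves G S" using True by auto
    have "game_value G Builder (insert u S) \<le> k"
      using u True "2.prems" by (intro "2.IH") (auto simp: legal_moves_def)
    then have "Min ((\<lambda>u. game_value G Builder (insert u S)) ` legal_moves G S) \<le> k"
      using fin u by (intro Min.coboundedI[THEN order_trans]) auto
    then show ?thesis using True by (simp add: game_value.simps(2)[of G S])
  qed (use "2.prems" in \<open>auto simp: game_value.simps(2)[of G S]\<close>)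
qed

lemma game_value_Blocker_le:
  assumes "finite (verts G)" "v \<in> legal_moves G S"
  shows "game_value G Blocker S \<le> game_value G Builder (insert v S)"
proof -
  have "finite (legal_moves G S)" using assms(1) by (simp add: legal_moves_def)
  then show ?thesis using assms by (auto simp: game_value.simps(2)[of G S] intro!: Min_le)
qed

theorem theorem5p1:
  fixes T :: "('a, 'b) pre_digraph"
  assumes "undirected_tree T"
  shows "int (gp_game' T) \<le> int (num_leaves T) - int (max_degree T) + 2"
proof -
  interpret graph T using assms by (simp add: undirected_tree_def)
  interpret undirected_tree_graph T by unfold_locales (rule assms)
  have "verts T \<noteq> {}" using assms by (simp add: undirected_tree_def connected_conv)
  then have "max_degree T \<in> out_degree T ` verts T"
    unfolding max_degree_def by (intro Max_in) auto
  then obtain v where v: "v \<in> verts T" "out_degree T v = max_degree T" by auto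
  have "card (set p \<inter> {v}) \<le> 2" for p
    using card_mono[of "{v}" "set p \<inter> {v}"] by simp
  then have gp: "general_position T {v}" using v by (simp add: general_position_def)
  have "gp_game' T \<le> game_value T Builder {v}"
    using game_value_Blocker_le[of T v "{}"] v gp by (simp add: gp_game'_def legal_moves_def)
  also have "\<dots> \<le> card leaves + 2 - max_degree T"
    using gp
  proof (rule game_value_le)
    fix S assume "general_position T S" "{v} \<subseteq> S"
    then show "card S \<le> card leaves + 2 - max_degree T"
      using general_position_card_le[of S v] v by simp
  qed
  finally have "gp_game' T \<le> card leaves + 2 - max_degree T" .
  moreover have "max_degree T \<le> card leaves + 2"
    using general_position_card_le[OF gp] v by simp
  ultimately show ?thesis by (simp add: num_leaves_def leaves_def)
qed

end
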